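(* The strong left overlap division $\mathcal S$ on the monomials of $R\langle x_1,\dots,x_n\rangle$ is continuous (both when thin divisors and when thick divisors are used to define involutive divisibility).
   Context: Monomials are words in the noncommuting variables $x_1,\dots,x_n$. An involutive division is a rule $I$ assigning to any finite set $U$ of monomials and any $u\in U$ a set $\mathcal M^L_I(u,U)\subseteq\{x_1,\dots,x_n\}$ of left multiplicative variables and a set $\mathcal M^R_I(u,U)\subseteq\{x_1,\dots,x_n\}$ of right multiplicative variables; the remaining variables are called left (respectively right) nonmultiplicative for $u$. For $u\in U$ and a monomial $v$, write $u\mid_I v$ ($u$ involutively divides $v$) if $v=v_1uv_2$ for some monomials $v_1,v_2$ such that: (thin divisors) the last letter of $v_1$ (if it exists) lies in $\mathcal M^L_I(u,U)$ and the first letter of $v_2$ (if it exists) lies in $\mathcal M^R_I(u,U)$; or (thick divisors) all letters of $v_1$ lie in $\mathcal M^L_I(u,U)$ and all letters of $v_2$ lie in $\mathcal M^R_I(u,U)$. DegRevLex ordering (with $x_1>x_2>\cdots>x_n$): $m_1<m_2$ if $\deg m_1<\deg m_2$, or the degrees are equal and, reading from right to left, at the first position where the words differ the letter of $m_1$ is greater than that of $m_2$. Strong left overlap division $\mathcal S$. Let $U=\{u_1,\dots,u_m\}$ be a set of monomials, listed so that $u_1\ge u_2\ge\cdots\ge u_m$ in DegRevLex. All variables are left multiplicative for all elements of $U$. Right multiplicative variables are determined as follows, starting with all variables right multiplicative for all elements of $U$. Step 1: (a) whenever $u_j\in U$ occurs as a subword of a different $u_i\in U$ at a position that is not the suffix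 position, make the letter of $u_i$ immediately to the right of that occurrence right nonmultiplicative for $u_j$; (b) whenever $u_i,u_j\in U$ (possibly equal) and $1\le k<\min(\deg u_i,\deg u_j)$ are such that the prefix of $u_i$ of length $k$ equals the suffix of $u_j$ of length $k$, make the $(k+1)$-st letter of $u_i$ right nonmultiplicative for $u_j$. Step 2: for $i=m,m-1,\dots,1$ and, for each such $i$, for $j=m,m-1,\dots,1$: if no letter occurring in $u_j$ is currently right nonmultiplicative for $u_i$, make the first letter of $u_j$ right nonmultiplicative for $u_i$. Continuity. Let $I$ be a fixed involutive division, let $w$ be a fixed monomial, let $U$ be any set of monomials, and consider any sequence $(u_1,u_2,\dots,u_k)$ of monomials from $U$, each of which is a conventional divisor of $w$, so that $w=\ell_iu_ir_i$ for all $1\le i\le k$, where the $\ell_i$ and $r_i$ are monomials. For all $1\le i<k$, suppose that $u_{i+1}$ satisfies exactly one of the following conditions: (a) $\deg(\ell_i)\ge1$, the last letter $x$ of $\ell_i$ is not in $\mathcal M^L_I(u_i,U)$, and $u_{i+1}\mid_I xu_i$; (b) $\deg(r_i)\ge1$, the first letter $x$ of $r_i$ is not in $\mathcal M^R_I(u_i,U)$, and $u_{i+1}\mid_I u_ix$. Then $I$ is continuous at $w$ if all the pairs $(\ell_i,r_i)$ are distinct, i.e. $(\ell_i,r_i)\neq(\ell_j,r_j)$ for all $i\ne j$. $I$ is continuous if it is continuous at $w$ for all possible $w$.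
   Formalization: In the definition of continuity, the pair (l_{i+1}, r_{i+1}) is required to locate u_{i+1} in w at the place where it involutively divides the prolongation x u_i or u_i x; with unrelated factorizations the claim fails (U={xx}, w=xxx). *)

theory Defs
  imports Main
begin

text \<open>
  The variable \<open>x\<^sub>i\<close> is represented by its index \<open>i \<in> {1..n}\<close>, a monomial by the list of its
  letters, and the set of all monomials in \<open>x\<^sub>1, \<dots>, x\<^sub>n\<close> by \<^term>\<open>lists {1..n}\<close>.  The coefficient
  ring of the free algebra plays no role.
\<close>

type_synonym monomial = "nat list"

text \<open>
  A division assigns to \<open>u\<close> and \<open>U\<close> the left (first component) and the right (second component)
  multiplicative variables of \<open>u\<close> with respect to \<open>U\<close>.  Only its values at finite \<open>U\<close> and
  \<open>u \<in> U\<close> matter.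
\<close>

type_synonym division =
  "(monomial \<Rightarrow> monomial set \<Rightarrow> nat set) \<times> (monomial \<Rightarrow> monomial set \<Rightarrow> nat set)"

abbreviation left_mult :: "division \<Rightarrow> monomial \<Rightarrow> monomial set \<Rightarrow> nat set" where
  "left_mult I \<equiv> fst I"

abbreviation right_mult :: "division \<Rightarrow> monomial \<Rightarrow> monomial set \<Rightarrow> nat set" where
  "right_mult I \<equiv> snd I"

definition involutive_division :: "nat \<Rightarrow> division \<Rightarrow> bool" where
  "involutive_division n I \<longleftrightarrow>
     (\<forall>U u. finite U \<and> U \<subseteq> lists {1..n} \<and> u \<in> U \<longrightarrow>
        left_mult I u U \<subseteq> {1..n} \<and> right_mult I u U \<subseteq> {1..n})"

datatype divisor_kind = Thin | Thick

fun mult_cofactors ::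
  "divisor_kind \<Rightarrow> division \<Rightarrow> monomial set \<Rightarrow> monomial \<Rightarrow> monomial \<Rightarrow> monomial \<Rightarrow> bool" where
  "mult_cofactors Thin I U u v1 v2 \<longleftrightarrow>
     (v1 \<noteq> [] \<longrightarrow> last v1 \<in> left_mult I u U) \<and> (v2 \<noteq> [] \<longrightarrow> hd v2 \<in> right_mult I u U)"
| "mult_cofactors Thick I U u v1 v2 \<longleftrightarrow>
     set v1 \<subseteq> left_mult I u U \<and> set v2 \<subseteq> right_mult I u U"

definition inv_divides ::
  "divisor_kind \<Rightarrow> division \<Rightarrow> monomial set \<Rightarrow> monomial \<Rightarrow> monomial \<Rightarrow> bool" where
  "inv_divides d I U u v \<longleftrightarrow> (\<exists>v1 v2. v = v1 @ u @ v2 \<and> mult_cofactors d I U u v1 v2)"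


text \<open>
  Conditions (a) and (b) on the successor \<open>u'\<close> of \<open>u\<close> in a sequence of divisors, where
  \<open>w = l u r\<close>.
\<close>

definition left_prolongation ::
  "divisor_kind \<Rightarrow> division \<Rightarrow> monomial set \<Rightarrow> monomial \<Rightarrow> monomial \<Rightarrow> monomial \<Rightarrow> bool" where
  "left_prolongation d I U l u u' \<longleftrightarrow>
     l \<noteq> [] \<and> last l \<notin> left_mult I u U \<and> inv_divides d I U u' (last l # u)"

definition right_prolongation ::
  "divisor_kind \<Rightarrow> division \<Rightarrow> monomial set \<Rightarrow> monomial \<Rightarrow> monomial \<Rightarrow> monomial \<Rightarrow> bool" where
  "right_prolongation d I U u r u' \<longleftrightarrow>
     r \<noteq> [] \<and> hd r \<notin> right_mult I u U \<and> inv_divides d I U u' (u @ [hd r])"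

text \<open>
  The pair \<open>(l', r')\<close> locates \<open>u'\<close> in \<open>w\<close> at the place where it involutively divides the
  prolongation of the preceding divisor.  If \<open>u'\<close> were allowed to sit at an unrelated occurrence
  in \<open>w\<close>, continuity would fail for trivial reasons: for \<open>U = {x\<^sub>1x\<^sub>1}\<close> and \<open>w = x\<^sub>1x\<^sub>1x\<^sub>1\<close>, the
  sequence \<open>x\<^sub>1x\<^sub>1, x\<^sub>1x\<^sub>1\<close> could use the pair \<open>(1, x\<^sub>1)\<close> twice.
\<close>

definition placed_left :: "divisor_kind \<Rightarrow> division \<Rightarrow> monomial set \<Rightarrow>
    monomial \<Rightarrow> monomial \<Rightarrow> monomial \<Rightarrow> monomial \<Rightarrow> monomial \<Rightarrow> monomial \<Rightarrow> bool" where
  "placed_left d I U l u r l' u' r' \<longleftrightarrow>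
     (\<exists>v1 v2. last l # u = v1 @ u' @ v2 \<and> mult_cofactors d I U u' v1 v2 \<and>
        l' = butlast l @ v1 \<and> r' = v2 @ r)"

definition placed_right :: "divisor_kind \<Rightarrow> division \<Rightarrow> monomial set \<Rightarrow>
    monomial \<Rightarrow> monomial \<Rightarrow> monomial \<Rightarrow> monomial \<Rightarrow> monomial \<Rightarrow> monomial \<Rightarrow> bool" where
  "placed_right d I U l u r l' u' r' \<longleftrightarrow>
     (\<exists>v1 v2. u @ [hd r] = v1 @ u' @ v2 \<and> mult_cofactors d I U u' v1 v2 \<and>
        l' = l @ v1 \<and> r' = v2 @ tl r)"

text \<open>The inequality of the two truth values below says that exactly one of them holds.\<close>

definition continuous_at ::
  "divisor_kind \<Rightarrow> nat \<Rightarrow> division \<Rightarrow> monomial \<Rightarrow> bool" where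
  "continuous_at d n I w \<longleftrightarrow>
     (\<forall>U (k :: nat) u l r.
        finite U \<and> U \<subseteq> lists {1..n} \<and>
        (\<forall>i\<in>{1..k}. u i \<in> U \<and> w = l i @ u i @ r i) \<and>
        (\<forall>i\<in>{1..<k}.
           left_prolongation d I U (l i) (u i) (u (i + 1)) \<noteq>
             right_prolongation d I U (u i) (r i) (u (i + 1)) \<and>
           (left_prolongation d I U (l i) (u i) (u (i + 1)) \<longrightarrow>
              placed_left d I U (l i) (u i) (r i) (l (i + 1)) (u (i + 1)) (r (i + 1))) \<and>
           (right_prolongation d I U (u i) (r i) (u (i + 1)) \<longrightarrow>
              placed_right d I U (l i) (u i) (r i) (l (i + 1)) (u (i + 1)) (r (i + 1))))
        \<longrightarrow> (\<forall>i\<in>{1..k}. \<forall>j\<in>{1..k}. i \<noteq> j \<longrightarrow> (l i, r i) \<noteq> (l j, r j)))"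

definition division_continuous :: "divisor_kind \<Rightarrow> nat \<Rightarrow> division \<Rightarrow> bool" where
  "division_continuous d n I \<longleftrightarrow> (\<forall>w\<in>lists {1..n}. continuous_at d n I w)"


text \<open>Since \<open>x\<^sub>1 > x\<^sub>2 > \<dots> > x\<^sub>n\<close>, the greater variable is the one with the smaller index.\<close>

definition var_greater :: "nat \<Rightarrow> nat \<Rightarrow> bool" where
  "var_greater a b \<longleftrightarrow> a < b"

definition degrevlex_less :: "monomial \<Rightarrow> monomial \<Rightarrow> bool" where
  "degrevlex_less m1 m2 \<longleftrightarrow>
     length m1 < length m2 \<or>
     length m1 = length m2 \<and>
       (\<exists>i<length m1. var_greater (m1 ! i) (m2 ! i) \<and>
          (\<forall>j. i < j \<and> j < length m1 \<longrightarrow> m1 ! j = m2 ! j))"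

lemma degrevlex_irrefl: "\<not> degrevlex_less a a"
  by (auto simp: degrevlex_less_def var_greater_def)

lemma degrevlex_trans:
  assumes "degrevlex_less a b" "degrevlex_less b c"
  shows "degrevlex_less a c"
proof (cases "length a = length b \<and> length b = length c")
  case True
  obtain i where i: "i < length a" "a ! i < b ! i" "\<forall>j. i < j \<and> j < length a \<longrightarrow> a ! j = b ! j"
    using assms(1) True by (auto simp: degrevlex_less_def var_greater_def)
  obtain j where j: "j < length a" "b ! j < c ! j" "\<forall>i. j < i \<and> i < length a \<longrightarrow> b ! i = c ! i"
    using assms(2) True by (auto simp: degrevlex_less_def var_greater_def)
  have "a ! max i j < c ! max i j"
    using i j by (cases i j rule: linorder_cases) auto
  moreover have "max i j < length a" "\<forall>k. max i j < k \<and> k < length a \<longrightarrow> a ! k = c ! k"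
    using i j by auto
  ultimately show ?thesis
    using True unfolding degrevlex_less_def var_greater_def by metis
next
  case False
  then show ?thesis
    using assms by (auto simp: degrevlex_less_def)
qed

lemma degrevlex_total:
  assumes "a \<noteq> b"
  shows "degrevlex_less a b \<or> degrevlex_less b a"
proof (cases "length a = length b")
  case True
  define D where "D = {i. i < length a \<and> a ! i \<noteq> b ! i}"
  have fin: "finite D" by (simp add: D_def)
  have "D \<noteq> {}" using assms True by (auto simp: D_def list_eq_iff_nth_eq)
  then have M: "Max D \<in> D" using fin by simp
  have above: "a ! j = b ! j" if "Max D < j" "j < length a" for j
  proof (rule ccontr)
    assume "a ! j \<noteq> b ! j"
    then have "j \<in> D" using that by (simp add: D_def)
    then show False using that(1) Max_ge[OF fin] by (simp add: leD)
  qed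
  have "a ! Max D < b ! Max D \<or> b ! Max D < a ! Max D"
    using M by (auto simp: D_def)
  moreover have "Max D < length a" using M by (auto simp: D_def)
  ultimately show ?thesis
    using True above unfolding degrevlex_less_def var_greater_def by metis
next
  case False
  then show ?thesis by (auto simp: degrevlex_less_def)
qed

definition descending_list :: "monomial set \<Rightarrow> monomial list" where
  "descending_list U = (THE us. set us = U \<and> sorted_wrt (\<lambda>u v. degrevlex_less v u) us)"

lemma descending_list_unique:
  assumes "finite U"
  shows "\<exists>!us. set us = U \<and> sorted_wrt (\<lambda>u v. degrevlex_less v u) us"
proof -
  interpret desc: linorder "\<lambda>u v. u = v \<or> degrevlex_less v u" "\<lambda>u v. degrevlex_less v u"
    by unfold_locales (use degrevlex_irrefl degrevlex_trans degrevlex_total in blast)+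
  show ?thesis
    using desc.finite_sorted_distinct_unique[OF assms] by (simp add: desc.strict_sorted_iff)
qed


text \<open>The empty monomial occurs as a subword at every position, in accordance with the definition.\<close>

definition subword_nonmult :: "monomial set \<Rightarrow> monomial \<Rightarrow> nat set" where
  "subword_nonmult U u = {y. \<exists>v\<in>U. v \<noteq> u \<and> (\<exists>p q. v = p @ u @ y # q)}"

text \<open>List indices start at \<open>0\<close>, so that \<open>v ! k\<close> is the \<open>(k + 1)\<close>-st letter of \<open>v\<close>.\<close>

definition overlap_nonmult :: "monomial set \<Rightarrow> monomial \<Rightarrow> nat set" where
  "overlap_nonmult U u =
     {v ! k | v k. v \<in> U \<and> 1 \<le> k \<and> k < min (length v) (length u) \<and>
        take k v = drop (length u - k) u}"

definition step1_nonmult :: "monomial set \<Rightarrow> monomial \<Rightarrow> nat set" where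
  "step1_nonmult U u = subword_nonmult U u \<union> overlap_nonmult U u"

text \<open>
  The second step transforms the assignment \<open>N\<close> of right nonmultiplicative variables to
  monomials.  The empty monomial has no first letter, so it has no effect in the role of \<open>u\<^sub>j\<close>.
\<close>

definition step2_update ::
  "monomial \<Rightarrow> monomial \<Rightarrow> (monomial \<Rightarrow> nat set) \<Rightarrow> (monomial \<Rightarrow> nat set)" where
  "step2_update ui uj N =
     (if uj \<noteq> [] \<and> set uj \<inter> N ui = {} then N(ui := insert (hd uj) (N ui)) else N)"

definition strong_nonmult :: "monomial set \<Rightarrow> monomial \<Rightarrow> nat set" where
  "strong_nonmult U =
     (let us = rev (descending_list U)
      in fold (\<lambda>ui. fold (step2_update ui) us) us (step1_nonmult U))"

definition strong_left_overlap :: "nat \<Rightarrow> division" where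
  "strong_left_overlap n = (\<lambda>u U. {1..n}, \<lambda>u U. {1..n} - strong_nonmult U u)"

lemma involutive_division_strong_left_overlap:
  "involutive_division n (strong_left_overlap n)"
  by (auto simp: involutive_division_def strong_left_overlap_def)

end

(* Every variable is left multiplicative, so only right prolongations u x occur in a sequence.
   If the next divisor u' is a suffix of u x, the right cofactor loses a letter.  Otherwise u' is
   a subword of u, and the first letter to the right of it is multiplicative for u'; Step 1 (a)
   excludes every occurrence except a suffix of u.  Since x separates u from u', this suffix is
   proper, so the left cofactor grows while the right one stays.  Hence deg l - deg r strictly
   increases along the sequence. *)

theory Submission
  imports Defs
begin

lemma step2_update_subset: "N u \<subseteq> step2_update ui uj N u"
  by (auto simp: step2_update_def)

lemma fold_subset:
  assumes "\<And>x N. N u \<subseteq> f x N u"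
  shows "N u \<subseteq> fold f xs N u"
proof (induction xs arbitrary: N)
  case (Cons x xs)
  show ?case using order_trans[OF assms[of N x] Cons.IH[of "f x N"]] by simp
qed simp

text \<open>Step 2 only ever inserts variables, so both nested folds preserve what Step 1 has made
  nonmultiplicative.\<close>

lemma step1_subset_strong_nonmult: "step1_nonmult U u \<subseteq> strong_nonmult U u"
  unfolding strong_nonmult_def Let_def by (intro fold_subset step2_update_subset)

text \<open>Thin divisibility tests exactly this letter and thick divisibility tests it among
  others, so one argument serves both kinds.\<close>

lemma hd_right_mult_if_mult_cofactors:
  assumes "mult_cofactors d I U u v1 v2" "v2 \<noteq> []"
  shows "hd v2 \<in> right_mult I u U"
  using assms by (cases d) auto

text \<open>The left multiplicative set is \<open>{1..n}\<close>, not all of \<open>nat\<close>,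
  hence the restriction on the letters of \<open>l\<close>.\<close>

lemma not_left_prolongation_strong_left_overlap:
  assumes "l \<in> lists {1..n}"
  shows "\<not> left_prolongation d (strong_left_overlap n) U l u u'"
  using assms last_in_set[of l]
  by (auto simp: left_prolongation_def strong_left_overlap_def in_lists_conv_set)

lemma right_mult_not_inner_subword:
  assumes "p @ u @ y # q \<in> U"
  shows "y \<notin> right_mult (strong_left_overlap n) u U"
proof -
  have "p @ u @ y # q \<noteq> u" by simp
  then have "y \<in> step1_nonmult U u"
    using assms unfolding step1_nonmult_def subword_nonmult_def by blast
  then show ?thesis
    using step1_subset_strong_nonmult by (auto simp: strong_left_overlap_def)
qed

lemma placed_right_degree_increase:
  assumes "u \<in> U"
    and prol: "right_prolongation d (strong_left_overlap n) U u r u'"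
    and placed: "placed_right d (strong_left_overlap n) U l u r l' u' r'"
  shows "int (length l) - int (length r) < int (length l') - int (length r')"
proof -
  let ?R = "\<lambda>u. right_mult (strong_left_overlap n) u U"
  obtain x s where r: "r = x # s" and x: "x \<notin> ?R u"
    using prol by (cases r) (auto simp: right_prolongation_def)
  obtain v1 v2 where eq: "u @ [x] = v1 @ u' @ v2"
    and mult: "mult_cofactors d (strong_left_overlap n) U u' v1 v2"
    and l': "l' = l @ v1" and r': "r' = v2 @ s"
    using placed by (auto simp: placed_right_def r)
  show ?thesis
  proof (cases v2 rule: rev_cases)
    case Nil
    then show ?thesis by (simp add: l' r' r)
  next
    case (snoc t z)
    then have z: "z = x" and u: "u = v1 @ u' @ t"
      using eq by auto
    \<comment> \<open>Otherwise the first letter of \<open>t\<close> follows \<open>u'\<close>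
      inside \<open>u\<close>: multiplicative as head of \<open>v2\<close>, nonmultiplicative by
      Step 1 (a).\<close>
    have "t = []"
    proof (cases t)
      case (Cons y q)
      then have "y \<in> ?R u'"
        using hd_right_mult_if_mult_cofactors[OF mult] snoc by simp
      moreover have "y \<notin> ?R u'"
        using \<open>u \<in> U\<close> by (intro right_mult_not_inner_subword[of v1 _ _ q]) (simp add: u Cons)
      ultimately show ?thesis by simp
    qed
    then have "x \<in> ?R u'"
      using hd_right_mult_if_mult_cofactors[OF mult] snoc z by simp
    \<comment> \<open>If \<open>v1\<close> were empty, \<open>u'\<close> would equal
      \<open>u\<close>, for which \<open>x\<close> is nonmultiplicative.\<close>
    then have "v1 \<noteq> []"
      using x u \<open>t = []\<close> by auto
    then show ?thesis
      by (simp add: l' r' r snoc \<open>t = []\<close>)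
  qed
qed

lemma increasing_on_interval:
  fixes f :: "nat \<Rightarrow> 'a::order"
  assumes "\<And>i. i \<in> {1..<k} \<Longrightarrow> f i < f (i + 1)" "1 \<le> i" "i < j" "j \<le> k"
  shows "f i < f j"
  using assms(3,4)
proof (induction j)
  case (Suc j)
  have "f j < f (Suc j)" using assms(1)[of j] assms(2) Suc.prems by simp
  then show ?case using Suc by (cases "i = j") (auto intro: less_trans)
qed simp

lemma division_continuous_strong_left_overlap:
  "division_continuous d n (strong_left_overlap n)"
  unfolding division_continuous_def continuous_at_def
proof (intro ballI allI impI, elim conjE)
  let ?I = "strong_left_overlap n"
  fix w U and k :: nat and u l r i j
  assume w: "w \<in> lists {1..n}"
    and div: "\<forall>i\<in>{1..k}. u i \<in> U \<and> w = l i @ u i @ r i"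
    and steps: "\<forall>i\<in>{1..<k}.
      left_prolongation d ?I U (l i) (u i) (u (i + 1)) \<noteq>
        right_prolongation d ?I U (u i) (r i) (u (i + 1)) \<and>
      (left_prolongation d ?I U (l i) (u i) (u (i + 1)) \<longrightarrow>
        placed_left d ?I U (l i) (u i) (r i) (l (i + 1)) (u (i + 1)) (r (i + 1))) \<and>
      (right_prolongation d ?I U (u i) (r i) (u (i + 1)) \<longrightarrow>
        placed_right d ?I U (l i) (u i) (r i) (l (i + 1)) (u (i + 1)) (r (i + 1)))"
    and ij: "i \<in> {1..k}" "j \<in> {1..k}" "i \<noteq> j"
  \<comment> \<open>Integers are used because subtraction on \<open>nat\<close> would
    truncate.\<close>
  define f where "f i = int (length (l i)) - int (length (r i))" for i
  have step: "f i < f (i + 1)" if i: "i \<in> {1..<k}" for i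
  proof -
    have "u i \<in> U" "w = l i @ u i @ r i" using div i by auto
    then have "l i \<in> lists {1..n}" using w by auto
    \<comment> \<open>Exactly one kind of prolongation occurs; as the left one is excluded, it is
      the right one, whose placement makes \<open>f\<close> increase.\<close>
    then show ?thesis
      unfolding f_def
      using steps i not_left_prolongation_strong_left_overlap
        placed_right_degree_increase[OF \<open>u i \<in> U\<close>] by blast
  qed
  have "f i \<noteq> f j"
    using ij increasing_on_interval[of k f i j, OF step]
      increasing_on_interval[of k f j i, OF step]
    by (cases i j rule: linorder_cases) auto
  then show "(l i, r i) \<noteq> (l j, r j)"
    by (auto simp: f_def)
qed

theorem proposition5p5p19:
  fixes n :: nat
  shows "division_continuous Thin n (strong_left_overlap n)
       \<and> division_continuous Thick n (strong_left_overlap n)"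
  using division_continuous_strong_left_overlap by simp

end
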